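(* Let $\Sigma_1$ and $\Sigma_2$ be two signed graphs, with $\Sigma_2$ having at least one negative edge. Then the HG-lexicographic product satisfies $\operatorname{bdim}(\Sigma_1[\Sigma_2])\geq 3$.
   Context: A signed graph $\Sigma=(G,\sigma)$ is a graph $G=(V,E)$ with a function $\sigma:E\to\{+1,-1\}$. All graphs and signed graphs are finite, simple, connected and undirected unless otherwise mentioned. Let $\Omega=\{-1,0,1\}$, with $\Omega^k\subset\mathbb{R}^k$ carrying the standard inner product $\langle\cdot,\cdot\rangle$. A vector valued switching function ($k$-switching function) for $\Sigma$ is a map $\zeta:V\to\Omega^k$ with $\langle\zeta(u),\zeta(v)\rangle\neq 0$ for every edge $uv\in E$; the switched signed graph $\Sigma^\zeta=(G,\sigma^\zeta)$ has $\sigma^\zeta(uv)=\sigma(uv)\operatorname{sgn}(\langle\zeta(u),\zeta(v)\rangle)$. The balancing dimension $\operatorname{bdim}(\Sigma)$ is the least integer $k\ge 1$ for which there is a $k$-switching function $\zeta:V\to\Omega^k$ such that $\Sigma^\zeta$ is all-positive (every edge has sign $+1$). The lexicographic product $G_1[G_2]$ of graphs has vertex set $V(G_1)\times V(G_2)$, with $(u_i,v_j)$ adjacent to $(u_k,v_l)$ iff $u_i\sim u_k$ in $G_1$, or $u_i=u_k$ and $v_j\sim v_l$ in $G_2$. The HG-lexicographic product $\Sigma_1[\Sigma_2]$ of $\Sigma_1=(G_1,\sigma_1)$ and $\Sigma_2=(G_2,\sigma_2)$ is the signed graph on $G_1[G_2]$ with signature $\sigma((u_i,v_j)(u_k,v_l))=\sigma_1(u_iu_k)$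 if $i\ne k$, and $=\sigma_2(v_jv_l)$ if $i=k$.
   Formalization: The formal statement additionally assumes that Σ1 has at least one edge; for Σ1 = K1 the product is Σ2 itself, and a single negative edge Σ2 has balancing dimension 1, so the claim fails there. *)

theory Defs
  imports "Graph_Theory.Graph_Theory" "Jordan_Normal_Form.Matrix" "HOL-Library.FuncSet"
begin

text \<open>An undirected edge \<open>uv\<close> is represented by the two arcs \<open>(u, v)\<close> and \<open>(v, u)\<close>, so that a
  simple undirected graph is a \<^locale>\<open>pair_graph\<close> and the signature is required to agree on
  opposite arcs. Signs are real numbers since they get multiplied by \<^const>\<open>sgn\<close> of a real inner
  product; values of the signature outside the arc set are irrelevant.\<close>

record 'a sgraph =
  graph_of :: "'a pair_pre_digraph"
  sign :: "'a \<times> 'a \<Rightarrow> real"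

definition signed_graph :: "'a sgraph \<Rightarrow> bool" where
  "signed_graph S \<longleftrightarrow>
     pair_graph (graph_of S) \<and> connected (with_proj (graph_of S)) \<and>
     (\<forall>e \<in> parcs (graph_of S). sign S e \<in> {1, -1}) \<and>
     (\<forall>(u, v) \<in> parcs (graph_of S). sign S (v, u) = sign S (u, v))"

definition all_positive :: "'a sgraph \<Rightarrow> bool" where
  "all_positive S \<longleftrightarrow> (\<forall>e \<in> parcs (graph_of S). sign S e = 1)"

definition Omega_vecs :: "nat \<Rightarrow> real vec set" where
  "Omega_vecs k = {x \<in> carrier_vec k. \<forall>i<k. x $ i \<in> {-1, 0, 1}}"

definition switching_function :: "nat \<Rightarrow> 'a sgraph \<Rightarrow> ('a \<Rightarrow> real vec) \<Rightarrow> bool" where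
  "switching_function k S \<zeta> \<longleftrightarrow>
     \<zeta> \<in> pverts (graph_of S) \<rightarrow> Omega_vecs k \<and>
     (\<forall>(u, v) \<in> parcs (graph_of S). \<zeta> u \<bullet> \<zeta> v \<noteq> 0)"

definition switched :: "'a sgraph \<Rightarrow> ('a \<Rightarrow> real vec) \<Rightarrow> 'a sgraph" where
  "switched S \<zeta> =
     \<lparr>graph_of = graph_of S, sign = (\<lambda>(u, v). sign S (u, v) * sgn (\<zeta> u \<bullet> \<zeta> v))\<rparr>"

text \<open>The set of admissible \<open>k\<close> is nonempty for every signed graph
  (lemma \<open>positive_switching_exists\<close> below), so the minimum is attained.\<close>

definition bdim :: "'a sgraph \<Rightarrow> nat" where
  "bdim S = (LEAST k. k \<ge> 1 \<and> (\<exists>\<zeta>. switching_function k S \<zeta> \<and> all_positive (switched S \<zeta>)))"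

definition lex_graph ::
    "'a pair_pre_digraph \<Rightarrow> 'b pair_pre_digraph \<Rightarrow> ('a \<times> 'b) pair_pre_digraph" where
  "lex_graph G H =
     \<lparr>pverts = pverts G \<times> pverts H,
      parcs = {((u, v), (u', v')) | u v u' v'.
        u \<in> pverts G \<and> v \<in> pverts H \<and> u' \<in> pverts G \<and> v' \<in> pverts H \<and>
        ((u, u') \<in> parcs G \<or> u = u' \<and> (v, v') \<in> parcs H)}\<rparr>"

definition hg_lex :: "'a sgraph \<Rightarrow> 'b sgraph \<Rightarrow> ('a \<times> 'b) sgraph" where
  "hg_lex S T =
     \<lparr>graph_of = lex_graph (graph_of S) (graph_of T),
      sign = (\<lambda>((u, v), (u', v')). if u \<noteq> u' then sign S (u, u') else sign T (v, v'))\<rparr>"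

lemma positive_switching_exists:
  assumes S: "signed_graph S"
  shows "\<exists>k\<ge>1. \<exists>\<zeta>. switching_function k S \<zeta> \<and> all_positive (switched S \<zeta>)"
proof -
  let ?A = "parcs (graph_of S)"
  interpret pair_graph "graph_of S" using S by (simp add: signed_graph_def)
  have fin: "finite ?A" by (rule pair_finite_arcs)
  then obtain f :: "nat \<Rightarrow> _" where f: "bij_betw f {0..<card ?A} ?A"
    using ex_bij_betw_nat_finite by blast
  have sg: "sign S e = 1 \<or> sign S e = -1" if "e \<in> ?A" for e
    using S that by (auto simp: signed_graph_def)
  have sgsym: "sign S (v, u) = sign S (u, v)" if "(u, v) \<in> ?A" for u v
    using S that by (auto simp: signed_graph_def)
  define c :: "_ \<Rightarrow> _ \<Rightarrow> real" where
    "c = (\<lambda>x e. if x = fst e then 1 else if x = snd e then sign S e else 0)"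
  define k where "k = Suc (card ?A)"
  define \<zeta> where "\<zeta> = (\<lambda>x. vec k (\<lambda>i. if i < card ?A then c x (f i) else 0))"
  have ip: "\<zeta> u \<bullet> \<zeta> v = (\<Sum>e\<in>?A. c u e * c v e)" for u v
  proof -
    have "\<zeta> u \<bullet> \<zeta> v = (\<Sum>i\<in>{0..<card ?A}. c u (f i) * c v (f i))"
      by (simp add: scalar_prod_def \<zeta>_def k_def)
    also have "\<dots> = (\<Sum>e\<in>?A. c u e * c v e)"
      using sum.reindex_bij_betw[OF f, of "\<lambda>e. c u e * c v e"] .
    finally show ?thesis .
  qed
  have ipe: "\<zeta> u \<bullet> \<zeta> v = 2 * sign S (u, v)" if uv: "(u, v) \<in> ?A" for u v
  proof -
    have ne: "u \<noteq> v" using pair_no_loops[OF uv] by simp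
    have vu: "(v, u) \<in> ?A" using pair_sym_arcs uv by (auto simp: symmetric_def sym_def)
    have "(\<Sum>e\<in>?A. c u e * c v e) = (\<Sum>e\<in>{(u, v), (v, u)}. c u e * c v e)"
      by (rule sum.mono_neutral_right) (use uv vu fin ne in \<open>auto simp: c_def split: if_splits\<close>)
    also have "\<dots> = 2 * sign S (u, v)"
      using ne sgsym[OF uv] by (simp add: c_def)
    finally show ?thesis by (simp add: ip)
  qed
  have fA: "f i \<in> ?A" if "i < card ?A" for i using f that by (auto simp: bij_betw_def)
  have "c x e \<in> {-1, 0, 1}" if "e \<in> ?A" for x e
    using sg[OF that] by (auto simp: c_def)
  then have "\<zeta> x \<in> Omega_vecs k" for x
    using fA by (simp add: Omega_vecs_def \<zeta>_def)
  moreover have "\<zeta> u \<bullet> \<zeta> v \<noteq> 0" if "(u, v) \<in> ?A" for u v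
    using ipe[OF that] sg[OF that] by auto
  ultimately have "switching_function k S \<zeta>"
    by (auto simp: switching_function_def)
  moreover have "all_positive (switched S \<zeta>)"
    using sg by (fastforce simp: all_positive_def switched_def ipe)
  ultimately show ?thesis by (intro exI[of _ k]) (auto simp: k_def)
qed

end

theory Submission
  imports Defs
begin

text \<open>An edge of \<open>\<Sigma>1\<close> and a negative edge of \<open>\<Sigma>2\<close> span in \<open>\<Sigma>1[\<Sigma>2]\<close> a \<open>K\<^sub>4\<close>
  with two disjoint negative edges whose four remaining edges share one sign. After possibly
  negating the two vectors at one of the negative edges, a positive \<open>k\<close>-switching function would
  assign to it vectors \<open>a, b, c, d\<close> such that \<open>a, b\<close> and \<open>c, d\<close> enclose obtuse angles and the four
  mixed pairs acute ones. In the plane this is impossible: \<open>c\<close> is then a positive combination of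
  \<open>a\<close> and \<open>b\<close>, so \<open>\<langle>c, d\<rangle>\<close> would be positive.\<close>

text \<open>\<open>connected\<close> refers to strong connectivity of the symmetric closure. The
  arcs of a \<open>pair_graph\<close> are already symmetric, so taking this closure does not change
  reachability.\<close>

lemma connected_pair_graph_iff:
  assumes "pair_graph G"
  shows "connected (with_proj G) \<longleftrightarrow>
    pverts G \<noteq> {} \<and> (\<forall>u\<in>pverts G. \<forall>v\<in>pverts G. (u, v) \<in> rtrancl_on (pverts G) (parcs G))"
proof -
  interpret pair_graph G by fact
  have "u \<rightarrow>\<^sup>*\<^bsub>with_proj (mk_symmetric (with_proj G))\<^esub> v \<longleftrightarrow>
      (u, v) \<in> rtrancl_on (pverts G) (parcs G)" for u v
    using reachable_mk_symmetric_eq[OF sym_arcs] by (simp add: reachable_def)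
  then show ?thesis by (simp add: connected_def strongly_connected_def)
qed

lemma parcs_lex_graph_iff:
  "((u, v), (u', v')) \<in> parcs (lex_graph G H) \<longleftrightarrow>
    u \<in> pverts G \<and> v \<in> pverts H \<and> u' \<in> pverts G \<and> v' \<in> pverts H \<and>
    ((u, u') \<in> parcs G \<or> u = u' \<and> (v, v') \<in> parcs H)"
  by (simp add: lex_graph_def)

lemma pverts_lex_graph [simp]: "pverts (lex_graph G H) = pverts G \<times> pverts H"
  by (simp add: lex_graph_def)

lemma pair_graph_lex_graph:
  assumes "pair_graph G" and "pair_graph H"
  shows "pair_graph (lex_graph G H)"
proof -
  interpret G: pair_graph G by fact
  interpret H: pair_graph H by fact
  have sub: "parcs (lex_graph G H) \<subseteq> (pverts G \<times> pverts H) \<times> (pverts G \<times> pverts H)"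
    by (auto simp: lex_graph_def)
  have fin: "finite (parcs (lex_graph G H))"
    by (rule finite_subset[OF sub]) (simp add: G.pair_finite_verts H.pair_finite_verts)
  have "(u', u) \<in> parcs G" if "(u, u') \<in> parcs G" for u u'
    using G.pair_sym_arcs that by (auto simp: symmetric_def sym_def)
  moreover have "(v', v) \<in> parcs H" if "(v, v') \<in> parcs H" for v v'
    using H.pair_sym_arcs that by (auto simp: symmetric_def sym_def)
  ultimately have "symmetric (with_proj (lex_graph G H))"
    by (auto simp: symmetric_def sym_def parcs_lex_graph_iff)
  moreover have "(u, u) \<notin> parcs G" "(v, v) \<notin> parcs H" for u v
    using G.pair_no_loops H.pair_no_loops by fastforce+
  ultimately show ?thesis
    using sub fin G.pair_finite_verts H.pair_finite_verts
    by unfold_locales (auto simp: parcs_lex_graph_iff)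
qed

text \<open>A walk first changes the first coordinate with \<open>v\<close> fixed, then the second
  one inside the copy of \<open>H\<close> over \<open>u'\<close>.\<close>

lemma connected_lex_graph:
  assumes G: "pair_graph G" "connected (with_proj G)"
    and H: "pair_graph H" "connected (with_proj H)"
  shows "connected (with_proj (lex_graph G H))"
proof -
  let ?R = "rtrancl_on (pverts (lex_graph G H)) (parcs (lex_graph G H))"
  have first: "((u, v), (u', v)) \<in> ?R"
    if "(u, u') \<in> rtrancl_on (pverts G) (parcs G)" "v \<in> pverts H" for u u' v
    using that
  proof (induction rule: rtrancl_on_induct)
    case (step y z)
    then show ?case
      by - (rule rtrancl_on_into_rtrancl_on[of _ "(y, v)"], auto simp: parcs_lex_graph_iff)
  qed auto
  have second: "((u, v), (u, v')) \<in> ?R"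
    if "(v, v') \<in> rtrancl_on (pverts H) (parcs H)" "u \<in> pverts G" for u v v'
    using that
  proof (induction rule: rtrancl_on_induct)
    case (step y z)
    then show ?case
      by - (rule rtrancl_on_into_rtrancl_on[of _ "(u, y)"], auto simp: parcs_lex_graph_iff)
  qed auto
  have "((u, v), (u', v')) \<in> ?R"
    if "u \<in> pverts G" "u' \<in> pverts G" "v \<in> pverts H" "v' \<in> pverts H" for u u' v v'
  proof (rule rtrancl_on_trans)
    show "((u, v), (u', v)) \<in> ?R"
      using first that G by (simp add: connected_pair_graph_iff)
    show "((u', v), (u', v')) \<in> ?R"
      using second that H by (simp add: connected_pair_graph_iff)
  qed
  then show ?thesis
    using G H by (auto simp: connected_pair_graph_iff pair_graph_lex_graph)
qed

text \<open>Makes \<open>positive_switching_exists\<close> applicable to the product, so that the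
  minimum defining its \<open>bdim\<close> is attained.\<close>

lemma signed_graph_hg_lex:
  assumes S: "signed_graph S" and T: "signed_graph T"
  shows "signed_graph (hg_lex S T)"
proof -
  let ?L = "lex_graph (graph_of S) (graph_of T)"
  interpret S: pair_graph "graph_of S" using S by (simp add: signed_graph_def)
  have L: "pair_graph ?L" "connected (with_proj ?L)"
    using S T by (simp_all add: signed_graph_def pair_graph_lex_graph connected_lex_graph)
  have sg: "sign (hg_lex S T) ((u, v), (u', v')) \<in> {1, -1} \<and>
      sign (hg_lex S T) ((u', v'), (u, v)) = sign (hg_lex S T) ((u, v), (u', v'))"
    if "((u, v), (u', v')) \<in> parcs ?L" for u v u' v'
  \<comment> \<open>\<open>S\<close> has no loops, so on arcs of the product this case split agrees
    with the test \<open>u \<noteq> u'\<close> in \<open>hg_lex\<close>.\<close>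
  proof (cases "(u, u') \<in> parcs (graph_of S)")
    case True
    then show ?thesis
      using S S.pair_no_loops[OF True] by (auto simp: signed_graph_def hg_lex_def)
  next
    case False
    then show ?thesis
      using T that by (auto simp: signed_graph_def hg_lex_def parcs_lex_graph_iff)
  qed
  have "graph_of (hg_lex S T) = ?L" by (simp add: hg_lex_def)
  then show ?thesis
    unfolding signed_graph_def using L sg by auto
qed

lemma positive_switching_arc:
  assumes "signed_graph S" "switching_function k S \<zeta>" "all_positive (switched S \<zeta>)"
    and e: "(u, v) \<in> parcs (graph_of S)"
  shows "sign S (u, v) * (\<zeta> u \<bullet> \<zeta> v) > 0"
proof -
  have "sign S (u, v) * sgn (\<zeta> u \<bullet> \<zeta> v) = 1"
    using assms(3) e by (force simp: all_positive_def switched_def)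
  moreover have "sign S (u, v) \<in> {1, -1}"
    using assms(1) e by (auto simp: signed_graph_def)
  ultimately show ?thesis
    by (auto simp: sgn_if split: if_splits)
qed

lemma no_plane_obtuse_pairs:
  fixes a1 a2 b1 b2 c1 c2 d1 d2 :: real
  assumes "a1 * b1 + a2 * b2 < 0" and "c1 * d1 + c2 * d2 < 0"
    and "a1 * c1 + a2 * c2 > 0" "b1 * c1 + b2 * c2 > 0"
    and "a1 * d1 + a2 * d2 > 0" "b1 * d1 + b2 * d2 > 0"
  shows False
proof -
  define ab ac ad bc bd cd where defs:
    "ab = a1 * b1 + a2 * b2" "ac = a1 * c1 + a2 * c2" "ad = a1 * d1 + a2 * d2"
    "bc = b1 * c1 + b2 * c2" "bd = b1 * d1 + b2 * d2" "cd = c1 * d1 + c2 * d2"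
  have s: "ab < 0" "cd < 0" "ac > 0" "bc > 0" "ad > 0" "bd > 0"
    using assms by (simp_all add: defs)
  \<comment> \<open>Cramer's rule for \<open>c\<close> in terms of \<open>a\<close> and \<open>b\<close>, paired with \<open>d\<close>\<close>
  have "(a1 * b2 - a2 * b1)\<^sup>2 * cd
      = ((b1\<^sup>2 + b2\<^sup>2) * ac - ab * bc) * ad + ((a1\<^sup>2 + a2\<^sup>2) * bc - ab * ac) * bd"
    unfolding defs by (simp add: power2_eq_square algebra_simps)
  \<comment> \<open>Parallel \<open>a\<close> and \<open>b\<close> need no separate case: a
    vanishing determinant still makes the left side nonpositive, while the right side is strictly
    positive.\<close>
  moreover have "(a1 * b2 - a2 * b1)\<^sup>2 * cd \<le> 0"
    using s by (simp add: mult_nonneg_nonpos)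
  moreover have "(b1\<^sup>2 + b2\<^sup>2) * ac - ab * bc > 0" "(a1\<^sup>2 + a2\<^sup>2) * bc - ab * ac > 0"
    using s by (simp_all add: add_nonneg_pos mult_neg_pos diff_conv_add_uminus del: add_uminus_conv_diff)
  ultimately show False
    using s by (smt (verit) mult_pos_pos)
qed

text \<open>Reading missing coordinates as 0 embeds dimensions 0 and 1 into the plane.\<close>

lemma scalar_prod_dim_le_2:
  fixes x y :: "real vec"
  assumes "y \<in> carrier_vec k" and "k \<le> 2"
  shows "x \<bullet> y = (if 0 < k then x $ 0 else 0) * (if 0 < k then y $ 0 else 0) +
    (if 1 < k then x $ 1 else 0) * (if 1 < k then y $ 1 else 0)"
proof -
  have "k = 0 \<or> k = 1 \<or> k = 2" using assms(2) by auto
  then show ?thesis using assms(1) by (auto simp: scalar_prod_def numeral_2_eq_2)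
qed

text \<open>Here \<open>s\<close> is the common sign of the mixed edges. Replacing \<open>c\<close>,
  \<open>d\<close> by their multiples with \<open>s\<close> makes all mixed products
  positive.\<close>

lemma no_obtuse_pairs_dim_le_2:
  fixes a b c d :: "real vec"
  assumes "k \<le> 2" and "b \<in> carrier_vec k" "c \<in> carrier_vec k" "d \<in> carrier_vec k"
    and "a \<bullet> b < 0" "c \<bullet> d < 0" and "s * (a \<bullet> c) > 0" "s * (b \<bullet> c) > 0"
    and "s * (a \<bullet> d) > 0" "s * (b \<bullet> d) > 0"
  shows False
proof -
  define p q :: "real vec \<Rightarrow> real"
    where pq: "p x = (if 0 < k then x $ 0 else 0)" "q x = (if 1 < k then x $ 1 else 0)" for x
  have ip: "x \<bullet> y = p x * p y + q x * q y" if "y \<in> carrier_vec k" for x y :: "real vec"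
    using scalar_prod_dim_le_2[OF that assms(1)] by (simp add: pq)
  have "s * p c * (s * p d) + s * q c * (s * q d) = s\<^sup>2 * (c \<bullet> d)"
    by (simp add: ip[OF assms(4)] power2_eq_square algebra_simps)
  \<comment> \<open>The assumption on \<open>s * (a \<bullet> c)\<close> forces \<open>s\<close> to
    be nonzero, so the factor is positive.\<close>
  also have "\<dots> < 0"
    using assms by (intro mult_pos_neg) auto
  finally have "s * p c * (s * p d) + s * q c * (s * q d) < 0" .
  then show False
    using assms ip no_plane_obtuse_pairs[of "p a" "p b" "q a" "q b"
          "s * p c" "s * p d" "s * q c" "s * q d"]
    by (simp add: algebra_simps)
qed

theorem theorem2p11:
  fixes \<Sigma>1 :: "'a sgraph" and \<Sigma>2 :: "'b sgraph"
  assumes "signed_graph \<Sigma>1" and "signed_graph \<Sigma>2"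
    and "parcs (graph_of \<Sigma>1) \<noteq> {}"
    and "\<exists>e \<in> parcs (graph_of \<Sigma>2). sign \<Sigma>2 e = -1"
  shows "bdim (hg_lex \<Sigma>1 \<Sigma>2) \<ge> 3"
proof (rule ccontr)
  let ?P = "hg_lex \<Sigma>1 \<Sigma>2"
  interpret S1: pair_graph "graph_of \<Sigma>1" using assms(1) by (simp add: signed_graph_def)
  interpret S2: pair_graph "graph_of \<Sigma>2" using assms(2) by (simp add: signed_graph_def)
  have P: "signed_graph ?P" using assms(1,2) by (rule signed_graph_hg_lex)
  assume "\<not> bdim ?P \<ge> 3"
  then have k: "bdim ?P \<le> 2" by simp
  have "\<exists>\<zeta>. switching_function (bdim ?P) ?P \<zeta> \<and> all_positive (switched ?P \<zeta>)"
    using LeastI_ex[OF positive_switching_exists[OF P]] by (simp add: bdim_def)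
  then obtain \<zeta> where \<zeta>: "switching_function (bdim ?P) ?P \<zeta>" "all_positive (switched ?P \<zeta>)"
    by blast
  \<comment> \<open>Without an edge, connectedness leaves a single vertex, and the product is a copy
    of \<open>\<Sigma>2\<close>; for a single negative edge its balancing dimension is 1.\<close>
  obtain u u' where u: "(u, u') \<in> parcs (graph_of \<Sigma>1)" using assms(3) by auto
  obtain v v' where v: "(v, v') \<in> parcs (graph_of \<Sigma>2)" "sign \<Sigma>2 (v, v') = -1"
    using assms(4) by auto
  have ne: "u \<noteq> u'" using S1.pair_no_loops[OF u] by simp
  note V = S1.in_arcsD1[OF u] S1.in_arcsD2[OF u] S2.in_arcsD1[OF v(1)] S2.in_arcsD2[OF v(1)]
  have arc: "((x, y), (x', y')) \<in> parcs (graph_of ?P) \<longleftrightarrow>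
      ((x, y), (x', y')) \<in> parcs (lex_graph (graph_of \<Sigma>1) (graph_of \<Sigma>2))" for x y x' y'
    by (simp add: hg_lex_def)
  have carrier: "\<zeta> (x, y) \<in> carrier_vec (bdim ?P)"
    if "x \<in> pverts (graph_of \<Sigma>1)" "y \<in> pverts (graph_of \<Sigma>2)" for x y
    using \<zeta>(1) that by (auto simp: switching_function_def Omega_vecs_def hg_lex_def Pi_def)
  have inner: "\<zeta> (x, v) \<bullet> \<zeta> (x, v') < 0" if "x \<in> pverts (graph_of \<Sigma>1)" for x
    using positive_switching_arc[OF P \<zeta>, of "(x, v)" "(x, v')"] that v V
    by (simp add: arc parcs_lex_graph_iff) (simp add: hg_lex_def)
  \<comment> \<open>All vertices over \<open>u\<close> are joined to all vertices over
    \<open>u'\<close>, also for \<open>y = y'\<close>, and the sign depends only on the first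
    coordinates.\<close>
  have cross: "sign \<Sigma>1 (u, u') * (\<zeta> (u, y) \<bullet> \<zeta> (u', y')) > 0"
    if "y \<in> {v, v'}" "y' \<in> {v, v'}" for y y'
  proof -
    have "((u, y), (u', y')) \<in> parcs (graph_of ?P)"
      using that u V by (auto simp: arc parcs_lex_graph_iff)
    from positive_switching_arc[OF P \<zeta> this] show ?thesis
      using ne by (simp add: hg_lex_def)
  qed
  show False
    \<comment> \<open>The vectors over \<open>u\<close> serve as \<open>a\<close>, \<open>b\<close>
      and those over \<open>u'\<close> as \<open>c\<close>, \<open>d\<close>; \<open>a\<close> is
      the fourth one listed.\<close>
    by (rule no_obtuse_pairs_dim_le_2[OF k, of "\<zeta> (u, v')" "\<zeta> (u', v)" "\<zeta> (u', v')" "\<zeta> (u, v)"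
          "sign \<Sigma>1 (u, u')"])
      (auto intro: carrier inner cross V)
qed

end
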